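(* Let $X$ be an order-zero-dimensional space and $(Y,e)$ a Priestley order-compactification of $X$, and let $\mathcal{R}_Y=\{e^{-1}(U):U\in\mathsf{ClopUp}(Y)\}$. Then: (1) $(Y,e)$ is a Heyting order-compactification of $X$ iff $\mathcal{R}_Y$ is a Heyting basis of $X$; (2) $(Y,e)$ is an Esakia order-compactification of $X$ iff $\mathcal{R}_Y$ is an Esakia basis of $X$.
   Context: An ordered space is a set with a partial order $\le$ and a topology. For $S\subseteq X$, ${\uparrow}S,{\downarrow}S$ are the up/down-closures; ${\uparrow}_X x$ denotes $\{y\in X: x\le y\}$. $\mathsf{Up}(X)$ is the set of all upsets of $X$, a Heyting algebra under $\cup,\cap$ with implication $A\to B=\{x: {\uparrow}x\cap A\subseteq B\}$. $\mathsf{ClopUp}(X)$ is the set of clopen upsets. Priestley separation: $x\not\le y$ implies some clopen upset contains $x$ but not $y$. $X$ is order-zero-dimensional if it satisfies Priestley separation and $\{U\setminus V: U,V\in\mathsf{ClopUp}(X)\}$ is a basis. A Priestley space is a compact ordered space with Priestley separation. An ordered space is continuously ordered if ${\uparrow}x$ is closed for each $x$ and ${\downarrow}U$ is open for each open $U$. An Esakia space is a Priestley space that is continuously ordered (equivalently, a compact Hausdorff zero-dimensional continuously ordered space). A Nachbin space is a compact ordered space with closed order. An order-embedding is a topological embedding $e$ with $x\le y\iff e(x)\le e(y)$. A Priestley order-compactification of $X$ is a pair $(Y,e)$ with $Y$ a Priestley space and $e:X\to Y$ an order-embedding with dense image. It is a Heyting order-compactification if $Y$ is an Esakia space, and an Esakia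 order-compactification if moreover for each $x\in X$, $e[{\uparrow}_X x]$ is dense in ${\uparrow}_Y e(x)$. A ring of upsets of $X$ is a subset $\mathcal{R}\subseteq\mathsf{Up}(X)$ closed under finite unions and finite intersections (so containing $\varnothing$ and $X$); it is a Priestley ring if whenever $x\not\le y$ there is $A\in\mathcal{R}$ with $x\in A$, $y\notin A$; it is a Priestley basis if moreover $\{U\setminus V:U,V\in\mathcal{R}\}$ is a basis for the topology of $X$. A Priestley basis is a Heyting basis if the lattice $\mathcal{R}$ is a Heyting algebra, and an Esakia basis if $\mathcal{R}$ is a Heyting subalgebra of $\mathsf{Up}(X)$ (i.e. closed under the implication of $\mathsf{Up}(X)$). *)

theory Defs
  imports "HOL-Analysis.Analysis"
begin

text \<open>
  An ordered space is a pair of an abstract topology \<open>X\<close> and a relation \<open>le\<close>; its points are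
  \<open>topspace X\<close>, and \<open>le\<close> is only ever relevant on them.
\<close>

definition ordered_space :: "'a topology \<Rightarrow> ('a \<Rightarrow> 'a \<Rightarrow> bool) \<Rightarrow> bool" where
  "ordered_space X le \<longleftrightarrow>
     reflp_on (topspace X) le \<and> transp_on (topspace X) le \<and> antisymp_on (topspace X) le"

definition up_closure :: "'a topology \<Rightarrow> ('a \<Rightarrow> 'a \<Rightarrow> bool) \<Rightarrow> 'a set \<Rightarrow> 'a set" where
  "up_closure X le S = {y \<in> topspace X. \<exists>x\<in>S. le x y}"

definition down_closure :: "'a topology \<Rightarrow> ('a \<Rightarrow> 'a \<Rightarrow> bool) \<Rightarrow> 'a set \<Rightarrow> 'a set" where
  "down_closure X le S = {y \<in> topspace X. \<exists>x\<in>S. le y x}"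

definition Up :: "'a topology \<Rightarrow> ('a \<Rightarrow> 'a \<Rightarrow> bool) \<Rightarrow> 'a set set" where
  "Up X le = {A. A \<subseteq> topspace X \<and> (\<forall>x\<in>A. \<forall>y\<in>topspace X. le x y \<longrightarrow> y \<in> A)}"

definition up_imp ::
    "'a topology \<Rightarrow> ('a \<Rightarrow> 'a \<Rightarrow> bool) \<Rightarrow> 'a set \<Rightarrow> 'a set \<Rightarrow> 'a set" where
  "up_imp X le A B = {x \<in> topspace X. up_closure X le {x} \<inter> A \<subseteq> B}"

definition ClopUp :: "'a topology \<Rightarrow> ('a \<Rightarrow> 'a \<Rightarrow> bool) \<Rightarrow> 'a set set" where
  "ClopUp X le = {U \<in> Up X le. openin X U \<and> closedin X U}"

definition base_of :: "'a topology \<Rightarrow> 'a set set \<Rightarrow> bool" where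
  "base_of X \<B> \<longleftrightarrow> openin X = arbitrary union_of (\<lambda>S. S \<in> \<B>)"

definition separates_order ::
    "'a topology \<Rightarrow> ('a \<Rightarrow> 'a \<Rightarrow> bool) \<Rightarrow> 'a set set \<Rightarrow> bool" where
  "separates_order X le \<R> \<longleftrightarrow>
     (\<forall>x\<in>topspace X. \<forall>y\<in>topspace X. \<not> le x y \<longrightarrow> (\<exists>A\<in>\<R>. x \<in> A \<and> y \<notin> A))"

definition priestley_separation :: "'a topology \<Rightarrow> ('a \<Rightarrow> 'a \<Rightarrow> bool) \<Rightarrow> bool" where
  "priestley_separation X le \<longleftrightarrow> separates_order X le (ClopUp X le)"

definition order_zero_dimensional :: "'a topology \<Rightarrow> ('a \<Rightarrow> 'a \<Rightarrow> bool) \<Rightarrow> bool" where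
  "order_zero_dimensional X le \<longleftrightarrow>
     ordered_space X le \<and> priestley_separation X le \<and>
     base_of X {U - V |U V. U \<in> ClopUp X le \<and> V \<in> ClopUp X le}"

definition priestley_space :: "'a topology \<Rightarrow> ('a \<Rightarrow> 'a \<Rightarrow> bool) \<Rightarrow> bool" where
  "priestley_space X le \<longleftrightarrow>
     ordered_space X le \<and> compact_space X \<and> priestley_separation X le"

definition continuously_ordered :: "'a topology \<Rightarrow> ('a \<Rightarrow> 'a \<Rightarrow> bool) \<Rightarrow> bool" where
  "continuously_ordered X le \<longleftrightarrow>
     (\<forall>x\<in>topspace X. closedin X (up_closure X le {x})) \<and>
     (\<forall>U. openin X U \<longrightarrow> openin X (down_closure X le U))"

definition esakia_space :: "'a topology \<Rightarrow> ('a \<Rightarrow> 'a \<Rightarrow> bool) \<Rightarrow> bool" where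
  "esakia_space X le \<longleftrightarrow> priestley_space X le \<and> continuously_ordered X le"

definition order_embedding ::
    "'a topology \<Rightarrow> ('a \<Rightarrow> 'a \<Rightarrow> bool) \<Rightarrow> 'b topology \<Rightarrow> ('b \<Rightarrow> 'b \<Rightarrow> bool) \<Rightarrow> ('a \<Rightarrow> 'b) \<Rightarrow> bool" where
  "order_embedding X leX Y leY e \<longleftrightarrow>
     embedding_map X Y e \<and>
     (\<forall>x\<in>topspace X. \<forall>y\<in>topspace X. leX x y \<longleftrightarrow> leY (e x) (e y))"

definition priestley_order_compactification ::
    "'a topology \<Rightarrow> ('a \<Rightarrow> 'a \<Rightarrow> bool) \<Rightarrow> 'b topology \<Rightarrow> ('b \<Rightarrow> 'b \<Rightarrow> bool) \<Rightarrow> ('a \<Rightarrow> 'b) \<Rightarrow> bool" where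
  "priestley_order_compactification X leX Y leY e \<longleftrightarrow>
     priestley_space Y leY \<and> order_embedding X leX Y leY e \<and>
     Y closure_of (e ` topspace X) = topspace Y"

definition heyting_order_compactification ::
    "'a topology \<Rightarrow> ('a \<Rightarrow> 'a \<Rightarrow> bool) \<Rightarrow> 'b topology \<Rightarrow> ('b \<Rightarrow> 'b \<Rightarrow> bool) \<Rightarrow> ('a \<Rightarrow> 'b) \<Rightarrow> bool" where
  "heyting_order_compactification X leX Y leY e \<longleftrightarrow>
     priestley_order_compactification X leX Y leY e \<and> esakia_space Y leY"

definition esakia_order_compactification ::
    "'a topology \<Rightarrow> ('a \<Rightarrow> 'a \<Rightarrow> bool) \<Rightarrow> 'b topology \<Rightarrow> ('b \<Rightarrow> 'b \<Rightarrow> bool) \<Rightarrow> ('a \<Rightarrow> 'b) \<Rightarrow> bool" where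
  "esakia_order_compactification X leX Y leY e \<longleftrightarrow>
     heyting_order_compactification X leX Y leY e \<and>
     (\<forall>x\<in>topspace X.
        subtopology Y (up_closure Y leY {e x}) closure_of (e ` up_closure X leX {x})
          = up_closure Y leY {e x})"

definition ring_of_upsets ::
    "'a topology \<Rightarrow> ('a \<Rightarrow> 'a \<Rightarrow> bool) \<Rightarrow> 'a set set \<Rightarrow> bool" where
  "ring_of_upsets X le \<R> \<longleftrightarrow>
     \<R> \<subseteq> Up X le \<and> {} \<in> \<R> \<and> topspace X \<in> \<R> \<and>
     (\<forall>A\<in>\<R>. \<forall>B\<in>\<R>. A \<union> B \<in> \<R> \<and> A \<inter> B \<in> \<R>)"

definition priestley_ring ::
    "'a topology \<Rightarrow> ('a \<Rightarrow> 'a \<Rightarrow> bool) \<Rightarrow> 'a set set \<Rightarrow> bool" where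
  "priestley_ring X le \<R> \<longleftrightarrow> ring_of_upsets X le \<R> \<and> separates_order X le \<R>"

definition priestley_basis ::
    "'a topology \<Rightarrow> ('a \<Rightarrow> 'a \<Rightarrow> bool) \<Rightarrow> 'a set set \<Rightarrow> bool" where
  "priestley_basis X le \<R> \<longleftrightarrow>
     priestley_ring X le \<R> \<and> base_of X {U - V |U V. U \<in> \<R> \<and> V \<in> \<R>}"

text \<open>
  A lattice of sets is a Heyting algebra iff any two members \<open>A\<close>, \<open>B\<close> have a relative
  pseudocomplement \<open>C\<close> \<^emph>\<open>within the lattice\<close>; for a ring of upsets it need not be \<open>up_imp X le A B\<close>.
\<close>

definition heyting_lattice :: "'a set set \<Rightarrow> bool" where
  "heyting_lattice \<R> \<longleftrightarrow>
     (\<forall>A\<in>\<R>. \<forall>B\<in>\<R>. \<exists>C\<in>\<R>. \<forall>D\<in>\<R>. D \<subseteq> C \<longleftrightarrow> D \<inter> A \<subseteq> B)"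

definition heyting_basis ::
    "'a topology \<Rightarrow> ('a \<Rightarrow> 'a \<Rightarrow> bool) \<Rightarrow> 'a set set \<Rightarrow> bool" where
  "heyting_basis X le \<R> \<longleftrightarrow> priestley_basis X le \<R> \<and> heyting_lattice \<R>"

definition esakia_basis ::
    "'a topology \<Rightarrow> ('a \<Rightarrow> 'a \<Rightarrow> bool) \<Rightarrow> 'a set set \<Rightarrow> bool" where
  "esakia_basis X le \<R> \<longleftrightarrow>
     priestley_basis X le \<R> \<and> (\<forall>A\<in>\<R>. \<forall>B\<in>\<R>. up_imp X le A B \<in> \<R>)"

definition ring_of_compactification ::
    "'a topology \<Rightarrow> 'b topology \<Rightarrow> ('b \<Rightarrow> 'b \<Rightarrow> bool) \<Rightarrow> ('a \<Rightarrow> 'b) \<Rightarrow> 'a set set" where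
  "ring_of_compactification X Y leY e = {e -` U \<inter> topspace X |U. U \<in> ClopUp Y leY}"

lemma up_imp_in_Up: "ordered_space X le \<Longrightarrow> up_imp X le A B \<in> Up X le"
  unfolding ordered_space_def Up_def up_imp_def up_closure_def transp_on_def by blast

lemma subset_up_imp_iff:
  assumes "ordered_space X le" "D \<in> Up X le"
  shows "D \<subseteq> up_imp X le A B \<longleftrightarrow> D \<inter> A \<subseteq> B"
  using assms unfolding ordered_space_def Up_def up_imp_def up_closure_def reflp_on_def by blast

lemma heyting_lattice_Up: "ordered_space X le \<Longrightarrow> heyting_lattice (Up X le)"
  unfolding heyting_lattice_def by (metis up_imp_in_Up subset_up_imp_iff)

end

theory Submission
  imports Defs
begin

text \<open>
  In a Priestley space a point \<open>x\<close> and a closed set missing \<open>\<up>x\<close> are separated by a clopen upset.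
  Hence a relative pseudocomplement inside \<open>ClopUp Y\<close> is necessarily \<open>A \<rightarrow> B = Y - \<down>(A - B)\<close>, and as
  the sets \<open>A - B\<close> form a basis, \<open>Y\<close> is an Esakia space iff \<open>ClopUp Y\<close> is a Heyting algebra. Since
  \<open>e\<close> has dense image, \<open>U \<mapsto> e\<^sup>-\<^sup>1(U)\<close> is a lattice isomorphism from \<open>ClopUp Y\<close> onto \<open>\<R>\<^sub>Y\<close>, which
  gives (1). For (2), density of \<open>e[\<up>x]\<close> in \<open>\<up>e(x)\<close>, tested on the basic sets \<open>A - B\<close>, says exactly that
  this isomorphism carries the implication of \<open>Up Y\<close> to that of \<open>Up X\<close>.
\<close>

section \<open>Implication, down-closures and the lattice of clopen upsets\<close>

lemma up_imp_eq_diff_down_closure: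
  assumes "A \<subseteq> topspace X"
  shows "up_imp X le A B = topspace X - down_closure X le (A - B)"
  using assms unfolding up_imp_def up_closure_def down_closure_def by blast

lemma down_closure_diff_eq_diff_up_imp:
  assumes "A \<subseteq> topspace X"
  shows "down_closure X le (A - B) = topspace X - up_imp X le A B"
  using assms unfolding up_imp_def up_closure_def down_closure_def by blast

lemma ClopUp_subset_topspace: "U \<in> ClopUp X le \<Longrightarrow> U \<subseteq> topspace X"
  by (simp add: ClopUp_def Up_def)

lemma ClopUp_in_Up: "U \<in> ClopUp X le \<Longrightarrow> U \<in> Up X le"
  by (simp add: ClopUp_def)

lemma ClopUp_openin: "U \<in> ClopUp X le \<Longrightarrow> openin X U"
  and ClopUp_closedin: "U \<in> ClopUp X le \<Longrightarrow> closedin X U"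
  by (simp_all add: ClopUp_def)

lemma ClopUp_upward:
  "U \<in> ClopUp X le \<Longrightarrow> x \<in> U \<Longrightarrow> y \<in> topspace X \<Longrightarrow> le x y \<Longrightarrow> y \<in> U"
  by (auto simp: ClopUp_def Up_def)

lemma ClopUp_diff_openin:
  "U \<in> ClopUp X le \<Longrightarrow> V \<in> ClopUp X le \<Longrightarrow> openin X (U - V)"
  by (simp add: ClopUp_openin ClopUp_closedin openin_diff)

lemma ClopUp_diff_closedin:
  "U \<in> ClopUp X le \<Longrightarrow> V \<in> ClopUp X le \<Longrightarrow> closedin X (U - V)"
  by (simp add: ClopUp_openin ClopUp_closedin closedin_diff)

lemma ring_of_upsets_ClopUp: "ring_of_upsets X le (ClopUp X le)"
  unfolding ring_of_upsets_def ClopUp_def Up_def by auto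

lemma ClopUp_Int: "A \<in> ClopUp X le \<Longrightarrow> B \<in> ClopUp X le \<Longrightarrow> A \<inter> B \<in> ClopUp X le"
  and ClopUp_Un: "A \<in> ClopUp X le \<Longrightarrow> B \<in> ClopUp X le \<Longrightarrow> A \<union> B \<in> ClopUp X le"
  and topspace_ClopUp: "topspace X \<in> ClopUp X le"
  and empty_ClopUp: "{} \<in> ClopUp X le"
  using ring_of_upsets_ClopUp[of X le] by (auto simp: ring_of_upsets_def)

section \<open>Bases and separation by compactness in Priestley spaces\<close>

lemma base_of_iff:
  "base_of X \<B> \<longleftrightarrow>
     (\<forall>B\<in>\<B>. openin X B) \<and> (\<forall>W x. openin X W \<and> x \<in> W \<longrightarrow> (\<exists>B\<in>\<B>. x \<in> B \<and> B \<subseteq> W))"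
  unfolding base_of_def Ball_def Bex_def by (rule openin_topology_base_unique)

text \<open>The complements of the members of \<open>\<D>\<close> form an open cover of the compact
  set \<open>K\<close>. A finite subcover comes from finitely many members, and a member of
  \<open>\<D>\<close> lying below all of these misses \<open>K\<close>. This is the common
  compactness argument behind the basis and separation results below.\<close>

lemma closedin_disjoint_from_filtered_family:
  assumes "compact_space X" and K: "closedin X K"
    and clop: "\<And>D. D \<in> \<D> \<Longrightarrow> closedin X D"
    and top: "topspace X \<in> \<D>"
    and int: "\<And>D E. D \<in> \<D> \<Longrightarrow> E \<in> \<D> \<Longrightarrow> D \<inter> E \<in> \<D>"
    and sep: "\<And>z. z \<in> K \<Longrightarrow> \<exists>D\<in>\<D>. z \<notin> D"
  shows "\<exists>D\<in>\<D>. D \<inter> K = {}"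
proof -
  have "compactin X K"
    using assms(1) K by (simp add: closedin_compact_space)
  moreover have "K \<subseteq> \<Union>((\<lambda>D. topspace X - D) ` \<D>)"
    using sep closedin_subset[OF K] by blast
  moreover have "\<forall>U \<in> (\<lambda>D. topspace X - D) ` \<D>. openin X U"
    using clop by auto
  ultimately obtain \<F> where \<F>: "finite \<F>" "\<F> \<subseteq> (\<lambda>D. topspace X - D) ` \<D>" "K \<subseteq> \<Union>\<F>"
    unfolding compactin_def by meson
  then obtain \<E> where \<E>: "finite \<E>" "\<E> \<subseteq> \<D>" "\<F> = (\<lambda>D. topspace X - D) ` \<E>"
    by (metis finite_subset_image)
  \<comment> \<open>Closure under binary intersection gives the induction step;
    \<open>topspace X\<close> is the bound for the empty subfamily.\<close>
  have "\<exists>D\<in>\<D>. \<forall>E\<in>\<E>. D \<subseteq> E"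
    using \<E>(1,2)
  proof (induction rule: finite_induct)
    case empty
    then show ?case using top by blast
  next
    case (insert E \<E>)
    then obtain D where "D \<in> \<D>" "\<forall>E\<in>\<E>. D \<subseteq> E" by auto
    then have "D \<inter> E \<in> \<D>" "\<forall>E'\<in>insert E \<E>. D \<inter> E \<subseteq> E'"
      using int insert.prems by auto
    then show ?case by blast
  qed
  then obtain D where "D \<in> \<D>" "\<forall>E\<in>\<E>. D \<subseteq> E" by blast
  moreover from this have "D \<inter> K = {}"
    using \<F>(3) \<E>(3) by blast
  ultimately show ?thesis by blast
qed

text \<open>The differences \<open>U - V\<close> that contain a fixed point \<open>x\<close> are
  clopen and closed under intersection. Priestley separation makes them exclude every other point,
  so by compactness one of them misses the complement of a given neighbourhood of
  \<open>x\<close>.\<close>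

lemma priestley_space_base:
  assumes "priestley_space Y le"
  shows "base_of Y {U - V |U V. U \<in> ClopUp Y le \<and> V \<in> ClopUp Y le}"
  unfolding base_of_iff
proof (intro conjI ballI allI impI)
  fix B assume "B \<in> {U - V |U V. U \<in> ClopUp Y le \<and> V \<in> ClopUp Y le}"
  then show "openin Y B" by (auto intro: ClopUp_diff_openin)
next
  fix W x assume W: "openin Y W \<and> x \<in> W"
  then have x: "x \<in> topspace Y" using openin_subset by blast
  define \<D> where "\<D> = {U - V |U V. U \<in> ClopUp Y le \<and> V \<in> ClopUp Y le \<and> x \<in> U - V}"
  have "\<exists>D\<in>\<D>. D \<inter> (topspace Y - W) = {}"
  proof (rule closedin_disjoint_from_filtered_family)
    show "compact_space Y" using assms by (simp add: priestley_space_def)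
    show "closedin Y (topspace Y - W)" using W by blast
    show "closedin Y D" if "D \<in> \<D>" for D
      using that ClopUp_closedin[of _ Y le] ClopUp_openin[of _ Y le]
      by (auto simp: \<D>_def closedin_diff)
    show "topspace Y \<in> \<D>"
      unfolding \<D>_def using topspace_ClopUp[of Y le] empty_ClopUp[of Y le] x by blast
    show "D \<inter> E \<in> \<D>" if DE: "D \<in> \<D>" "E \<in> \<D>" for D E
    proof -
      obtain U V where D: "U \<in> ClopUp Y le" "V \<in> ClopUp Y le" "D = U - V" "x \<in> U - V"
        using DE(1) unfolding \<D>_def by blast
      obtain U' V' where E: "U' \<in> ClopUp Y le" "V' \<in> ClopUp Y le" "E = U' - V'" "x \<in> U' - V'"
        using DE(2) unfolding \<D>_def by blast
      have "D \<inter> E = (U \<inter> U') - (V \<union> V')" "x \<in> (U \<inter> U') - (V \<union> V')"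
        using D(3,4) E(3,4) by auto
      then show ?thesis
        unfolding \<D>_def using ClopUp_Int[OF D(1) E(1)] ClopUp_Un[OF D(2) E(2)] by blast
    qed
    show "\<exists>D\<in>\<D>. z \<notin> D" if "z \<in> topspace Y - W" for z
    proof -
      have z: "z \<in> topspace Y" "z \<noteq> x" using that W by auto
      \<comment> \<open>By antisymmetry, distinct points fail to be related in at least one
        direction. In the first case a clopen upset around \<open>x\<close> excludes
        \<open>z\<close>; in the second the complement of a clopen upset around \<open>z\<close>
        does.\<close>
      then consider "\<not> le x z" | "\<not> le z x"
        using assms x unfolding priestley_space_def ordered_space_def antisymp_on_def by blast
      then show ?thesis
      proof cases
        case 1
        then obtain U where "U \<in> ClopUp Y le" "x \<in> U" "z \<notin> U"
          using assms x z
          unfolding priestley_space_def priestley_separation_def separates_order_def by blast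
        then have "U - {} \<in> \<D>" "z \<notin> U - {}"
          unfolding \<D>_def using empty_ClopUp by blast+
        then show ?thesis by blast
      next
        case 2
        then obtain U where "U \<in> ClopUp Y le" "z \<in> U" "x \<notin> U"
          using assms x z
          unfolding priestley_space_def priestley_separation_def separates_order_def by blast
        then have "topspace Y - U \<in> \<D>" "z \<notin> topspace Y - U"
          unfolding \<D>_def using topspace_ClopUp x by blast+
        then show ?thesis by blast
      qed
    qed
  qed
  then obtain U V where UV: "U \<in> ClopUp Y le" "V \<in> ClopUp Y le" "x \<in> U - V"
    "(U - V) \<inter> (topspace Y - W) = {}"
    unfolding \<D>_def by blast
  have "U - V \<subseteq> W"
    using UV(4) ClopUp_subset_topspace[OF UV(1)] by blast
  with UV(1-3) show "\<exists>B\<in>{U - V |U V. U \<in> ClopUp Y le \<and> V \<in> ClopUp Y le}. x \<in> B \<and> B \<subseteq> W"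
    by blast
qed

lemma priestley_space_basic_openE:
  assumes "priestley_space Y le" "openin Y W" "x \<in> W"
  obtains U V where "U \<in> ClopUp Y le" "V \<in> ClopUp Y le" "x \<in> U - V" "U - V \<subseteq> W"
proof -
  have "\<exists>B\<in>{U - V |U V. U \<in> ClopUp Y le \<and> V \<in> ClopUp Y le}. x \<in> B \<and> B \<subseteq> W"
    using priestley_space_base[OF assms(1)] assms(2,3) unfolding base_of_iff by simp
  then obtain B where "B \<in> {U - V |U V. U \<in> ClopUp Y le \<and> V \<in> ClopUp Y le}" "x \<in> B" "B \<subseteq> W"
    by (elim bexE conjE)
  then show thesis using that by blast
qed

text \<open>No point of \<open>K\<close> lies above \<open>x\<close>, so each is excluded by some
  clopen upset containing \<open>x\<close>. Such upsets are closed under intersection, and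
  compactness turns pointwise separation into separation from all of \<open>K\<close>.\<close>

lemma priestley_space_separates_up_closure:
  assumes "priestley_space Y le" and x: "x \<in> topspace Y"
    and K: "closedin Y K" "up_closure Y le {x} \<inter> K = {}"
  shows "\<exists>D\<in>ClopUp Y le. x \<in> D \<and> D \<inter> K = {}"
proof -
  define \<D> where "\<D> = {D \<in> ClopUp Y le. x \<in> D}"
  have "\<exists>D\<in>\<D>. D \<inter> K = {}"
  proof (rule closedin_disjoint_from_filtered_family)
    show "compact_space Y" using assms(1) by (simp add: priestley_space_def)
    show "closedin Y K" by fact
    show "closedin Y D" if "D \<in> \<D>" for D
      using that ClopUp_closedin[of D Y le] by (simp add: \<D>_def)
    show "topspace Y \<in> \<D>" using x by (simp add: \<D>_def topspace_ClopUp)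
    show "D \<inter> E \<in> \<D>" if "D \<in> \<D>" "E \<in> \<D>" for D E
      using that by (simp add: \<D>_def ClopUp_Int)
    show "\<exists>D\<in>\<D>. z \<notin> D" if "z \<in> K" for z
    proof -
      have "z \<in> topspace Y" "\<not> le x z"
        using that K closedin_subset unfolding up_closure_def by blast+
      then show ?thesis
        using assms(1) x
        unfolding \<D>_def priestley_space_def priestley_separation_def separates_order_def by blast
    qed
  qed
  then show ?thesis unfolding \<D>_def by blast
qed

text \<open>By Priestley separation, \<up>x is the intersection of the clopen upsets containing
  \<open>x\<close>. One half of being continuously ordered thus holds in every Priestley
  space.\<close>

lemma priestley_space_closedin_up_closure:
  assumes "priestley_space Y le" and x: "x \<in> topspace Y"
  shows "closedin Y (up_closure Y le {x})"
proof -
  have "up_closure Y le {x} = topspace Y \<inter> \<Inter>{D \<in> ClopUp Y le. x \<in> D}"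
    using assms ClopUp_upward[of _ Y le x]
    unfolding up_closure_def priestley_space_def priestley_separation_def separates_order_def
    by blast
  also have "closedin Y \<dots>"
    \<comment> \<open>\<open>topspace Y\<close> belongs to the family, so the intersection is not
      over an empty family.\<close>
    using topspace_ClopUp[of Y le] x
    by (intro closedin_Int closedin_Inter) (auto simp: ClopUp_closedin)
  finally show ?thesis .
qed

text \<open>A point \<open>y\<close> outside \<down>K has \<up>y disjoint from \<open>K\<close>, so
  some clopen upset around \<open>y\<close> misses \<open>K\<close>. Being an upset, it misses
  \<down>K as well.\<close>

lemma priestley_space_closedin_down_closure:
  assumes "priestley_space Y le" and K: "closedin Y K"
  shows "closedin Y (down_closure Y le K)"
proof -
  have "\<exists>D. openin Y D \<and> y \<in> D \<and> D \<subseteq> topspace Y - down_closure Y le K"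
    if y: "y \<in> topspace Y - down_closure Y le K" for y
  proof -
    have "up_closure Y le {y} \<inter> K = {}"
      using y unfolding up_closure_def down_closure_def by blast
    then obtain D where D: "D \<in> ClopUp Y le" "y \<in> D" "D \<inter> K = {}"
      using priestley_space_separates_up_closure[OF assms(1) _ K, of y] y by blast
    have "D \<inter> down_closure Y le K = {}"
      using D(3) ClopUp_upward[OF D(1)] closedin_subset[OF K] unfolding down_closure_def by blast
    then show ?thesis
      using D(2) ClopUp_openin[OF D(1)] ClopUp_subset_topspace[OF D(1)] by blast
  qed
  then have "openin Y (topspace Y - down_closure Y le K)"
    by (subst openin_subopen) blast
  then show ?thesis
    unfolding closedin_def down_closure_def by blast
qed

section \<open>Esakia spaces and relative pseudocomplements of clopen upsets\<close>

lemma esakia_space_up_imp_in_ClopUp: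
  assumes E: "esakia_space Y le" and AB: "A \<in> ClopUp Y le" "B \<in> ClopUp Y le"
  shows "up_imp Y le A B \<in> ClopUp Y le"
proof -
  have P: "priestley_space Y le" using E by (simp add: esakia_space_def)
  then have "up_imp Y le A B \<in> Up Y le"
    by (intro up_imp_in_Up) (simp add: priestley_space_def)
  moreover have "up_imp Y le A B = topspace Y - down_closure Y le (A - B)"
    using AB by (simp add: up_imp_eq_diff_down_closure ClopUp_subset_topspace)
  \<comment> \<open>Openness is the Esakia condition; closedness is a consequence of the Priestley
    axioms.\<close>
  moreover have "openin Y (down_closure Y le (A - B))"
    using E ClopUp_diff_openin[OF AB] unfolding esakia_space_def continuously_ordered_def by blast
  moreover have "closedin Y (down_closure Y le (A - B))"
    by (rule priestley_space_closedin_down_closure[OF P ClopUp_diff_closedin[OF AB]])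
  ultimately show ?thesis
    unfolding ClopUp_def by (simp add: openin_diff closedin_diff)
qed

lemma esakia_space_iff_heyting_lattice_ClopUp:
  assumes P: "priestley_space Y le"
  shows "esakia_space Y le \<longleftrightarrow> heyting_lattice (ClopUp Y le)"
proof
  have ord: "ordered_space Y le" using P by (simp add: priestley_space_def)
  {
    assume E: "esakia_space Y le"
    show "heyting_lattice (ClopUp Y le)"
      unfolding heyting_lattice_def
    proof (intro ballI)
      fix A B assume "A \<in> ClopUp Y le" "B \<in> ClopUp Y le"
      then have "up_imp Y le A B \<in> ClopUp Y le"
        by (rule esakia_space_up_imp_in_ClopUp[OF E])
      moreover have "\<forall>D\<in>ClopUp Y le. D \<subseteq> up_imp Y le A B \<longleftrightarrow> D \<inter> A \<subseteq> B"
        by (intro ballI subset_up_imp_iff[OF ord] ClopUp_in_Up)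
      ultimately show "\<exists>C\<in>ClopUp Y le. \<forall>D\<in>ClopUp Y le. D \<subseteq> C \<longleftrightarrow> D \<inter> A \<subseteq> B"
        by (rule rev_bexI)
    qed
  }
  assume H: "heyting_lattice (ClopUp Y le)"
  have basic: "openin Y (down_closure Y le (A - B))"
    if AB: "A \<in> ClopUp Y le" "B \<in> ClopUp Y le" for A B
  proof -
    obtain C where C: "C \<in> ClopUp Y le" "\<forall>D\<in>ClopUp Y le. D \<subseteq> C \<longleftrightarrow> D \<inter> A \<subseteq> B"
      using bspec[OF bspec[OF H[unfolded heyting_lattice_def] AB(1)] AB(2)] by (rule bexE)
    \<comment> \<open>Testing the property of \<open>C\<close> on \<open>D = C\<close> gives
      \<open>C \<inter> A \<subseteq> B\<close>, and the implication is the largest upset with this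
      property.\<close>
    have "C \<subseteq> up_imp Y le A B"
      using bspec[OF C(2) C(1)] subset_up_imp_iff[OF ord ClopUp_in_Up[OF C(1)]] by simp
    \<comment> \<open>A clopen upset around \<open>x\<close> that misses \<open>A - B\<close>
      competes for the pseudocomplement and hence lies below \<open>C\<close>. So \<open>C\<close>
      is as large as the implication taken in all of \<open>Up Y le\<close>.\<close>
    moreover have "x \<in> C" if x: "x \<in> up_imp Y le A B" for x
    proof -
      have "x \<in> topspace Y" "up_closure Y le {x} \<inter> (A - B) = {}"
        using x unfolding up_imp_def by blast+
      then obtain D where D: "D \<in> ClopUp Y le" "x \<in> D" "D \<inter> (A - B) = {}"
        using priestley_space_separates_up_closure[OF P _ ClopUp_diff_closedin[OF AB]] by blast
      then have "D \<subseteq> C" using bspec[OF C(2) D(1)] by blast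
      with D(2) show ?thesis by blast
    qed
    ultimately have "up_imp Y le A B = C" by blast
    then show ?thesis
      using ClopUp_closedin[OF C(1)]
        down_closure_diff_eq_diff_up_imp[OF ClopUp_subset_topspace[OF AB(1)], of le B]
      by (simp add: openin_diff)
  qed
  have "openin Y (down_closure Y le W)" if W: "openin Y W" for W
  proof -
    define \<B> where "\<B> = {U - V |U V. U \<in> ClopUp Y le \<and> V \<in> ClopUp Y le \<and> U - V \<subseteq> W}"
    have cover: "\<exists>B\<in>\<B>. x \<in> B" if x: "x \<in> W" for x
    proof -
      obtain U V where "U \<in> ClopUp Y le" "V \<in> ClopUp Y le" "x \<in> U - V" "U - V \<subseteq> W"
        using priestley_space_basic_openE[OF P W x] .
      then show ?thesis unfolding \<B>_def by blast
    qed
    have "\<Union>\<B> = W"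
    proof
      show "\<Union>\<B> \<subseteq> W" unfolding \<B>_def by blast
      show "W \<subseteq> \<Union>\<B>" using cover by blast
    qed
    \<comment> \<open>Down-closure commutes with unions, so openness for basic sets is
      enough.\<close>
    then have "down_closure Y le W = (\<Union>B\<in>\<B>. down_closure Y le B)"
      unfolding down_closure_def by blast
    moreover have "openin Y (down_closure Y le B)" if "B \<in> \<B>" for B
      using that basic unfolding \<B>_def by blast
    ultimately show ?thesis by auto
  qed
  then show "esakia_space Y le"
    unfolding esakia_space_def continuously_ordered_def
    using P priestley_space_closedin_up_closure[OF P] by blast
qed

section \<open>Pulling clopen upsets back along the compactification\<close>

lemma embedding_map_openin_iff:
  assumes "embedding_map X Y e"
  shows "openin X W \<longleftrightarrow> (\<exists>V. openin Y V \<and> W = e -` V \<inter> topspace X)"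
proof -
  have h: "homeomorphic_map X (subtopology Y (e ` topspace X)) e"
    using assms by (simp add: embedding_map_def)
  then have inj: "inj_on e (topspace X)"
    by (simp add: homeomorphic_eq_everything_map)
  show ?thesis
  proof
    assume W: "openin X W"
    then have WX: "W \<subseteq> topspace X" by (rule openin_subset)
    have "openin (subtopology Y (e ` topspace X)) (e ` W)"
      using homeomorphic_map_openness[OF h WX] W by simp
    then obtain V where "openin Y V" "e ` W = V \<inter> e ` topspace X"
      unfolding openin_subtopology by blast
    \<comment> \<open>Injectivity of \<open>e\<close> recovers \<open>W\<close> from its
      image.\<close>
    moreover from this have "W = e -` V \<inter> topspace X"
      using WX inj unfolding inj_on_def by blast
    ultimately show "\<exists>V. openin Y V \<and> W = e -` V \<inter> topspace X" by blast
  next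
    assume "\<exists>V. openin Y V \<and> W = e -` V \<inter> topspace X"
    then obtain V where V: "openin Y V" "W = e -` V \<inter> topspace X" by blast
    have "continuous_map X Y e"
      using h homeomorphic_imp_continuous_map continuous_map_in_subtopology by blast
    then have "openin X {x \<in> topspace X. e x \<in> V}"
      using V(1) by (rule openin_continuous_map_preimage)
    moreover have "{x \<in> topspace X. e x \<in> V} = W" using V(2) by blast
    ultimately show "openin X W" by simp
  qed
qed

locale priestley_order_compactified =
  fixes X :: "'a topology" and leX :: "'a \<Rightarrow> 'a \<Rightarrow> bool"
    and Y :: "'b topology" and leY :: "'b \<Rightarrow> 'b \<Rightarrow> bool"
    and e :: "'a \<Rightarrow> 'b"
  assumes compactification: "priestley_order_compactification X leX Y leY e"
begin

abbreviation pull :: "'b set \<Rightarrow> 'a set" where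
  "pull U \<equiv> e -` U \<inter> topspace X"

abbreviation ring :: "'a set set" where
  "ring \<equiv> ring_of_compactification X Y leY e"

lemma priestley: "priestley_space Y leY"
  using compactification by (simp add: priestley_order_compactification_def)

lemma embedding: "embedding_map X Y e"
  using compactification
  by (simp add: priestley_order_compactification_def order_embedding_def)

lemma le_iff: "x \<in> topspace X \<Longrightarrow> y \<in> topspace X \<Longrightarrow> leX x y \<longleftrightarrow> leY (e x) (e y)"
  using compactification
  by (simp add: priestley_order_compactification_def order_embedding_def)

lemma in_topspace: "x \<in> topspace X \<Longrightarrow> e x \<in> topspace Y"
  using embedding_map_openin_iff[OF embedding, of "topspace X"] openin_subset by blast

text \<open>The open set \<open>U - C\<close> misses the dense image of \<open>e\<close>, hence is
  empty. This is how density lets inclusions in \<open>Y\<close> be checked on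
  \<open>X\<close>.\<close>

lemma open_subset_closed_if_pull_subset:
  assumes "openin Y U" "closedin Y C" "pull U \<subseteq> pull C"
  shows "U \<subseteq> C"
proof -
  have "openin Y (U - C)" using assms by blast
  moreover have "(U - C) \<inter> e ` topspace X = {}" using assms(3) by blast
  ultimately have "(U - C) \<inter> Y closure_of (e ` topspace X) = {}"
    by (simp add: openin_Int_closure_of_eq_empty)
  then show ?thesis
    using compactification openin_subset[OF assms(1)]
    unfolding priestley_order_compactification_def by auto
qed

lemma pull_in_ring: "U \<in> ClopUp Y leY \<Longrightarrow> pull U \<in> ring"
  unfolding ring_of_compactification_def by blast

lemma in_ringE:
  assumes "A \<in> ring" obtains U where "U \<in> ClopUp Y leY" "A = pull U"
  using assms unfolding ring_of_compactification_def by blast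

text \<open>Pulling back both preserves and reflects the inequality that defines relative
  pseudocomplements. Reflection uses density, as \<open>D \<inter> A\<close> is open and
  \<open>B\<close> is closed.\<close>

lemma pull_Int_subset_iff:
  assumes "A \<in> ClopUp Y leY" "B \<in> ClopUp Y leY" "D \<in> ClopUp Y leY"
  shows "pull D \<inter> pull A \<subseteq> pull B \<longleftrightarrow> D \<inter> A \<subseteq> B"
proof
  assume "pull D \<inter> pull A \<subseteq> pull B"
  then have "pull (D \<inter> A) \<subseteq> pull B" by blast
  then show "D \<inter> A \<subseteq> B"
    using assms ClopUp_Int ClopUp_openin ClopUp_closedin open_subset_closed_if_pull_subset by meson
qed blast

lemma pull_subset_iff:
  assumes "A \<in> ClopUp Y leY" "B \<in> ClopUp Y leY"
  shows "pull A \<subseteq> pull B \<longleftrightarrow> A \<subseteq> B"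
  using pull_Int_subset_iff[OF assms assms(1)] by simp

lemma ring_subset_Up: "ring \<subseteq> Up X leX"
proof
  fix A assume "A \<in> ring"
  then obtain U where "U \<in> ClopUp Y leY" "A = pull U" by (rule in_ringE)
  then show "A \<in> Up X leX"
    using ClopUp_upward[of U Y leY] in_topspace le_iff unfolding Up_def by blast
qed

text \<open>Separation is inherited because \<open>e\<close> reflects the order, and the basis
  property because \<open>X\<close> carries the topology induced from \<open>Y\<close>. In both
  parts of the theorem only the condition on implication then remains to be compared.\<close>

lemma priestley_basis_ring: "priestley_basis X leX ring"
proof -
  have "A \<union> B \<in> ring \<and> A \<inter> B \<in> ring" if AB: "A \<in> ring" "B \<in> ring" for A B
  proof -
    obtain U V where UV: "U \<in> ClopUp Y leY" "A = pull U" "V \<in> ClopUp Y leY" "B = pull V"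
      using AB by (metis in_ringE)
    have "A \<union> B = pull (U \<union> V)" "A \<inter> B = pull (U \<inter> V)" using UV by blast+
    then show ?thesis using UV pull_in_ring ClopUp_Un ClopUp_Int by metis
  qed
  moreover have "{} \<in> ring" using pull_in_ring[OF empty_ClopUp] by simp
  moreover have "topspace X \<in> ring"
  proof -
    have "pull (topspace Y) = topspace X" using in_topspace by blast
    then show ?thesis using pull_in_ring[OF topspace_ClopUp] by simp
  qed
  ultimately have ru: "ring_of_upsets X leX ring"
    unfolding ring_of_upsets_def using ring_subset_Up by blast
  have so: "separates_order X leX ring"
    unfolding separates_order_def
  proof (intro ballI impI)
    fix x y assume xy: "x \<in> topspace X" "y \<in> topspace X" "\<not> leX x y"
    then have "\<not> leY (e x) (e y)" by (simp add: le_iff)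
    then obtain U where U: "U \<in> ClopUp Y leY" "e x \<in> U" "e y \<notin> U"
      using priestley in_topspace[OF xy(1)] in_topspace[OF xy(2)]
      unfolding priestley_space_def priestley_separation_def separates_order_def by blast
    then show "\<exists>A\<in>ring. x \<in> A \<and> y \<notin> A"
      using xy(1) by (intro bexI[OF _ pull_in_ring[OF U(1)]]) simp
  qed
  have "base_of X {U - V |U V. U \<in> ring \<and> V \<in> ring}"
    unfolding base_of_iff
  proof (intro conjI ballI allI impI)
    fix B assume "B \<in> {U - V |U V. U \<in> ring \<and> V \<in> ring}"
    then obtain U V where UV: "U \<in> ClopUp Y leY" "V \<in> ClopUp Y leY" "B = pull U - pull V"
      unfolding ring_of_compactification_def by blast
    have "B = pull (U - V)" using UV(3) by blast
    then show "openin X B"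
      unfolding embedding_map_openin_iff[OF embedding] using ClopUp_diff_openin[OF UV(1,2)] by blast
  next
    fix W x assume Wx: "openin X W \<and> x \<in> W"
    then obtain W' where W': "openin Y W'" "W = pull W'"
      using embedding_map_openin_iff[OF embedding] by blast
    with Wx have "e x \<in> W'" by blast
    with W'(1) obtain U V where UV: "U \<in> ClopUp Y leY" "V \<in> ClopUp Y leY"
      "e x \<in> U - V" "U - V \<subseteq> W'"
      by (rule priestley_space_basic_openE[OF priestley])
    then have "x \<in> pull U - pull V" "pull U - pull V \<subseteq> W"
      using W'(2) Wx by auto
    then show "\<exists>B\<in>{U - V |U V. U \<in> ring \<and> V \<in> ring}. x \<in> B \<and> B \<subseteq> W"
      using pull_in_ring[OF UV(1)] pull_in_ring[OF UV(2)] by blast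
  qed
  then show ?thesis using ru so unfolding priestley_basis_def priestley_ring_def by blast
qed

text \<open>\<open>pull\<close> maps \<open>ClopUp Y leY\<close> onto \<open>ring\<close>, so
  quantifiers over \<open>ring\<close> become quantifiers over clopen upsets, and both inclusions in
  the definition are preserved and reflected.\<close>

lemma heyting_lattice_ring_iff: "heyting_lattice ring \<longleftrightarrow> heyting_lattice (ClopUp Y leY)"
proof -
  have ring_eq: "ring = pull ` ClopUp Y leY"
    unfolding ring_of_compactification_def by blast
  show ?thesis
    unfolding heyting_lattice_def ring_eq ball_simps bex_simps
    by (intro ball_cong bex_cong refl) (simp only: pull_Int_subset_iff pull_subset_iff)
qed

lemma heyting_order_compactification_iff:
  "heyting_order_compactification X leX Y leY e \<longleftrightarrow> heyting_basis X leX ring"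
  using compactification priestley_basis_ring heyting_lattice_ring_iff
    esakia_space_iff_heyting_lattice_ClopUp[OF priestley]
  unfolding heyting_order_compactification_def heyting_basis_def by blast

section \<open>Implication in \<open>Up X leX\<close> and density of principal upsets\<close>

lemma pull_up_imp_subset:
  "pull (up_imp Y leY A B) \<subseteq> up_imp X leX (pull A) (pull B)"
  unfolding up_imp_def up_closure_def using in_topspace le_iff by blast

lemma esakia_basis_if_esakia_order_compactification:
  assumes E: "esakia_order_compactification X leX Y leY e"
  shows "esakia_basis X leX ring"
proof -
  have esakia: "esakia_space Y leY"
    using E
    by (simp add: esakia_order_compactification_def heyting_order_compactification_def)
  \<comment> \<open>The definition takes the closure inside the subspace \<up>e(x); here it is
    replaced by the closure in \<open>Y\<close>.\<close>
  have dense: "up_closure Y leY {e x} \<subseteq> Y closure_of (e ` up_closure X leX {x})"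
    if "x \<in> topspace X" for x
    using E that closure_of_subtopology_subset
    unfolding esakia_order_compactification_def by metis
  have "up_imp X leX (pull A) (pull B) \<in> ring"
    if AB: "A \<in> ClopUp Y leY" "B \<in> ClopUp Y leY" for A B
  proof -
    have "x \<in> pull (up_imp Y leY A B)" if x: "x \<in> up_imp X leX (pull A) (pull B)" for x
    proof -
      have xX: "x \<in> topspace X" using x unfolding up_imp_def by blast
      \<comment> \<open>An open set missing e[\<up>x] misses its closure, and so misses \<up>e(x) by
        density. This gives the inclusion converse to \<open>pull_up_imp_subset\<close>.\<close>
      have "(A - B) \<inter> e ` up_closure X leX {x} = {}"
        using x unfolding up_imp_def up_closure_def by blast
      then have "(A - B) \<inter> Y closure_of (e ` up_closure X leX {x}) = {}"
        using ClopUp_diff_openin[OF AB] by (simp add: openin_Int_closure_of_eq_empty)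
      then show ?thesis
        using dense[OF xX] xX in_topspace unfolding up_imp_def by blast
    qed
    then have "up_imp X leX (pull A) (pull B) = pull (up_imp Y leY A B)"
      using pull_up_imp_subset by blast
    moreover have "up_imp Y leY A B \<in> ClopUp Y leY"
      using esakia_space_up_imp_in_ClopUp[OF esakia AB] .
    ultimately show ?thesis using pull_in_ring by simp
  qed
  then show ?thesis
    unfolding esakia_basis_def using priestley_basis_ring by (metis in_ringE)
qed

lemma esakia_order_compactification_if_esakia_basis:
  assumes ord: "ordered_space X leX" and E: "esakia_basis X leX ring"
  shows "esakia_order_compactification X leX Y leY e"
proof -
  have imp: "up_imp X leX A B \<in> ring" if "A \<in> ring" "B \<in> ring" for A B
    using E that unfolding esakia_basis_def by blast
  \<comment> \<open>The implication of \<open>Up X leX\<close> has the universal property against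
    all upsets, so once it lies in \<open>ring\<close> it is the relative pseudocomplement there.
    Part (1) then makes \<open>Y\<close> an Esakia space.\<close>
  then have "heyting_lattice ring"
    unfolding heyting_lattice_def
    using subset_up_imp_iff[OF ord subsetD[OF ring_subset_Up]] by meson
  then have H: "heyting_order_compactification X leX Y leY e"
    using heyting_order_compactification_iff priestley_basis_ring
    unfolding heyting_basis_def by blast
  have "up_closure Y leY {e x} \<subseteq> Y closure_of (e ` up_closure X leX {x})"
    if x: "x \<in> topspace X" for x
  proof
    fix z assume z: "z \<in> up_closure Y leY {e x}"
    then have zY: "z \<in> topspace Y" and le: "leY (e x) z" unfolding up_closure_def by auto
    have "\<exists>y\<in>e ` up_closure X leX {x}. y \<in> W" if W: "z \<in> W" "openin Y W" for W
    \<comment> \<open>Shrink \<open>W\<close> to a basic set \<open>A - B\<close> around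
      \<open>z\<close>. If it misses e[\<up>x], then \<open>x\<close> lies in the implication of the
      pullbacks, which is the pullback of a clopen upset \<open>C\<close> with
      \<open>C \<inter> A \<subseteq> B\<close>. Since \<open>z\<close> is above \<open>e x\<close>,
      it lies in \<open>C \<inter> A\<close> but not in \<open>B\<close>.\<close>
    proof (rule ccontr)
      assume neg: "\<not> ?thesis"
      obtain A B where AB: "A \<in> ClopUp Y leY" "B \<in> ClopUp Y leY" "z \<in> A - B" "A - B \<subseteq> W"
        using priestley_space_basic_openE[OF priestley W(2,1)] .
      have "x \<in> up_imp X leX (pull A) (pull B)"
        using neg AB(4) x unfolding up_imp_def up_closure_def by blast
      moreover obtain C where C: "C \<in> ClopUp Y leY" "up_imp X leX (pull A) (pull B) = pull C"
        using imp[OF pull_in_ring[OF AB(1)] pull_in_ring[OF AB(2)]] by (rule in_ringE)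
      ultimately have "e x \<in> C" by blast
      have "pull C \<inter> pull A \<subseteq> pull B"
        using subset_up_imp_iff[OF ord subsetD[OF ring_subset_Up pull_in_ring[OF C(1)]],
            of "pull A" "pull B"] C(2) by simp
      then have "C \<inter> A \<subseteq> B"
        using pull_Int_subset_iff[OF AB(1,2) C(1)] by simp
      with \<open>e x \<in> C\<close> show False
        using ClopUp_upward[OF C(1) _ zY le] AB(3) by blast
    qed
    then show "z \<in> Y closure_of (e ` up_closure X leX {x})"
      using zY unfolding in_closure_of by blast
  qed
  moreover have "e ` up_closure X leX {x} \<subseteq> up_closure Y leY {e x}" if "x \<in> topspace X" for x
    using that in_topspace le_iff unfolding up_closure_def by blast
  ultimately show ?thesis
    unfolding esakia_order_compactification_def using H
    by (simp add: closure_of_subtopology Int_absorb1 Int_absorb2)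
qed

end

theorem theorem4p11:
  fixes X :: "'a topology" and leX :: "'a \<Rightarrow> 'a \<Rightarrow> bool"
    and Y :: "'b topology" and leY :: "'b \<Rightarrow> 'b \<Rightarrow> bool"
    and e :: "'a \<Rightarrow> 'b"
  assumes "order_zero_dimensional X leX"
    and "priestley_order_compactification X leX Y leY e"
  shows "(heyting_order_compactification X leX Y leY e \<longleftrightarrow>
            heyting_basis X leX (ring_of_compactification X Y leY e)) \<and>
         (esakia_order_compactification X leX Y leY e \<longleftrightarrow>
            esakia_basis X leX (ring_of_compactification X Y leY e))"
proof -
  interpret priestley_order_compactified X leX Y leY e
    using assms(2) by unfold_locales
  have "ordered_space X leX"
    using assms(1) by (simp add: order_zero_dimensional_def)
  then show ?thesis
    using heyting_order_compactification_iff esakia_basis_if_esakia_order_compactification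
      esakia_order_compactification_if_esakia_basis by blast
qed

end
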